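(* Let $M$ and $N$ be positroids on $[n]$ with $\operatorname{rk}(M)=\operatorname{rk}(N)-1$. Let $\sigma^{:}$ and $\pi^{:}$ be the decorated permutations of $M$ and $N$, and $I^{\sigma}$ and $I^{\pi}$ their Grassmann necklaces, respectively. Then $I^{\sigma}_i\subseteq I^{\pi}_i$ for all $i\in[n]$ if and only if there exists $A\subseteq[n]$ such that $\sigma^{:}=\overrightarrow{\rho_A}(\pi^{:})$.
   Context: For $i\in[n]$ the cyclic order $<_i$ is $i<_i i+1<_i\cdots<_i n<_i 1<_i\cdots<_i i-1$; $A\leq_i B$ (Gale order, equal-size sets) means the $t$-th smallest element of $A$ under $<_i$ is $\leq_i$ the $t$-th smallest element of $B$, for all $t$. A decorated permutation on $[n]$ is a pair $(\pi,\operatorname{col})$, $\pi$ a permutation of $[n]$, $\operatorname{col}:[n]\to\{0,1,-1\}$ with $\operatorname{col}(i)=0$ iff $\pi(i)\ne i$ (fixed points with $\operatorname{col}=1$ are loops, with $\operatorname{col}=-1$ coloops). Its Grassmann necklace is $I_i=\{j: j<_i\pi^{-1}(j)\text{ or }\operatorname{col}(j)=-1\}$; its positroid has as bases the sets $B$ of size $|I_1|$ with $I_i\leq_i B$ for all $i$; every positroid has a unique decorated permutation and its necklace consists of the $\leq_i$-minimum bases. Cyclic shift: for $A\subseteq[n]$, $\overrightarrow{\rho_A}(\pi,\operatorname{col}_\pi)=(\sigma,\operatorname{col}_\sigma)$ where for $i\in A$, $\sigma(i)=\pi(i)$, $\operatorname{col}_\sigma(i)=\operatorname{col}_\pi(i)$;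 for $i\notin A$, $\sigma(i)=\pi(j)$ with $j$ the maximum element of $[n]\setminus A$ under $<_i$, and $\operatorname{col}_\sigma(i)=1$ if $\sigma(i)=i$, else $0$. *)

theory Defs
  imports "HOL-Library.FuncSet" "HOL-Combinatorics.Permutations"
begin

section \<open>Cyclic orders and Gale orders on \<open>{1..n}\<close>\<close>

text \<open>
  For \<open>a\<close> and \<open>i\<close> in \<open>{1..n}\<close> the order \<open>i <\<^sub>i i + 1 <\<^sub>i \<dots> <\<^sub>i n <\<^sub>i 1 <\<^sub>i \<dots> <\<^sub>i i - 1\<close> is the
  order of the integers obtained by adding \<open>n\<close> to every \<open>a < i\<close>.
\<close>

definition cyc_pos :: "nat \<Rightarrow> nat \<Rightarrow> nat \<Rightarrow> nat" where
  "cyc_pos n i a = (if i \<le> a then a else a + n)"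

definition cyc_less :: "nat \<Rightarrow> nat \<Rightarrow> nat \<Rightarrow> nat \<Rightarrow> bool" where
  "cyc_less n i a b \<longleftrightarrow> cyc_pos n i a < cyc_pos n i b"

definition cyc_le :: "nat \<Rightarrow> nat \<Rightarrow> nat \<Rightarrow> nat \<Rightarrow> bool" where
  "cyc_le n i a b \<longleftrightarrow> cyc_pos n i a \<le> cyc_pos n i b"

definition cyc_max :: "nat \<Rightarrow> nat \<Rightarrow> nat set \<Rightarrow> nat" where
  "cyc_max n i S = (THE j. j \<in> S \<and> (\<forall>k\<in>S. cyc_le n i k j))"

text \<open>Indices start at \<open>0\<close>, so the \<open>t\<close>-th entry of the sorted list is the \<open>(t+1)\<close>-st smallest element.\<close>

definition gale_le :: "nat \<Rightarrow> nat \<Rightarrow> nat set \<Rightarrow> nat set \<Rightarrow> bool" where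
  "gale_le n i A B \<longleftrightarrow>
     card A = card B \<and>
     (\<forall>t < card A. cyc_le n i (sorted_key_list_of_set (cyc_pos n i) A ! t)
                               (sorted_key_list_of_set (cyc_pos n i) B ! t))"

section \<open>Decorated permutations, Grassmann necklaces and positroids\<close>

type_synonym dperm = "(nat \<Rightarrow> nat) \<times> (nat \<Rightarrow> int)"

text \<open>
  The permutation is the identity and the colouring is \<open>undefined\<close> outside \<open>{1..n}\<close>, so equality of
  pairs is equality of decorated permutations of \<open>{1..n}\<close>.
\<close>

definition decorated_perm :: "nat \<Rightarrow> dperm \<Rightarrow> bool" where
  "decorated_perm n p \<longleftrightarrow>
     fst p permutes {1..n} \<and>
     snd p \<in> {1..n} \<rightarrow>\<^sub>E {0, 1, -1} \<and>
     (\<forall>i\<in>{1..n}. snd p i = 0 \<longleftrightarrow> fst p i \<noteq> i)"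

definition necklace :: "nat \<Rightarrow> dperm \<Rightarrow> nat \<Rightarrow> nat set" where
  "necklace n p i = {j \<in> {1..n}. cyc_less n i j (inv (fst p) j) \<or> snd p j = -1}"

text \<open>Positroids are represented by their families of bases.\<close>

definition positroid_of :: "nat \<Rightarrow> dperm \<Rightarrow> nat set set" where
  "positroid_of n p =
     {B. B \<subseteq> {1..n} \<and> card B = card (necklace n p 1) \<and>
         (\<forall>i\<in>{1..n}. gale_le n i (necklace n p i) B)}"

definition is_dperm_of :: "nat \<Rightarrow> dperm \<Rightarrow> nat set set \<Rightarrow> bool" where
  "is_dperm_of n p M \<longleftrightarrow> decorated_perm n p \<and> M = positroid_of n p"

definition positroid :: "nat \<Rightarrow> nat set set \<Rightarrow> bool" where
  "positroid n M \<longleftrightarrow> (\<exists>p. is_dperm_of n p M)"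

text \<open>The common cardinality of the bases.\<close>

definition rk :: "nat set set \<Rightarrow> nat" where
  "rk M = (THE k. card ` M = {k})"

section \<open>Cyclic shifts of decorated permutations\<close>

definition shift_perm :: "nat \<Rightarrow> nat set \<Rightarrow> (nat \<Rightarrow> nat) \<Rightarrow> nat \<Rightarrow> nat" where
  "shift_perm n A f i =
     (if i \<in> {1..n} - A then f (cyc_max n i ({1..n} - A)) else f i)"

definition cyclic_shift :: "nat \<Rightarrow> nat set \<Rightarrow> dperm \<Rightarrow> dperm" where
  "cyclic_shift n A p =
     (shift_perm n A (fst p),
      \<lambda>i. if i \<in> {1..n} - A then (if shift_perm n A (fst p) i = i then 1 else 0) else snd p i)"

end

theory Submission
  imports Defs
begin

text \<open>
  For a value \<open>v\<close> put \<open>a = \<pi>\<^sup>-\<^sup>1 v\<close> and \<open>b = \<sigma>\<^sup>-\<^sup>1 v\<close>. The indices \<open>i\<close> with \<open>v \<in> I\<^sup>\<pi>\<^sub>i\<close> form the cyclic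
  interval \<open>(a, v]\<close>, so containment of the necklaces says that \<open>a, b, v\<close> are in cyclic order, and
  \<open>v\<close> is missing from \<open>I\<^sup>\<sigma>\<^sub>i\<close> exactly for \<open>i\<close> in \<open>(a, b]\<close>. As the ranks differ by one, these
  intervals partition the circle, so each \<open>b\<close> is the cyclic successor of \<open>a\<close> among the interval
  ends; \<open>A\<close> is the set where the two decorated permutations agree. Conversely, a cyclic shift
  removes at most one element from each necklace entry, and the ranks force that it adds none.
\<close>

section \<open>Cyclic orders\<close>

lemma inj_on_cyc_pos: "inj_on (cyc_pos n i) {1..n}"
  by (auto simp: inj_on_def cyc_pos_def split: if_splits)

lemma cyc_less_if_le:
  assumes "cyc_le n i x y" "x \<noteq> y" "x \<in> {1..n}" "y \<in> {1..n}"
  shows "cyc_less n i x y"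
  using assms inj_onD[OF inj_on_cyc_pos, of n i x y]
  unfolding cyc_le_def cyc_less_def by linarith

text \<open>Passing from \<open><\<^sub>i\<close> to \<open><\<^sub>a\<close> moves the initial
  segment \<open>[i, a)\<close> behind all other elements and keeps the order inside both blocks;
  \<open>cyc_less n i x a\<close> tests membership in that segment.\<close>

lemma cyc_less_rotate:
  assumes "x \<in> {1..n}" "y \<in> {1..n}" "i \<in> {1..n}" "a \<in> {1..n}"
  shows "cyc_less n a x y \<longleftrightarrow>
    cyc_less n i x y \<and> (cyc_less n i x a \<longrightarrow> cyc_less n i y a) \<or>
    \<not> cyc_less n i x a \<and> cyc_less n i y a"
  using assms unfolding cyc_less_def cyc_pos_def
  by (cases "i \<le> x"; cases "i \<le> y"; cases "i \<le> a"; cases "a \<le> x"; cases "a \<le> y") auto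

text \<open>Anything beyond \<open>a\<close> in \<open><\<^sub>b\<close> lies in the open cyclic
  interval \<open>(a, b)\<close>, where \<open>k\<close> is forbidden. This identifies
  \<open>a\<close> as the maximum that a shift looks up at \<open>b\<close>.\<close>

lemma cyc_le_of_successor:
  assumes "cyc_less n i a b" "cyc_less n i a k \<Longrightarrow> \<not> cyc_less n i k b"
    and "i \<in> {1..n}" "a \<in> {1..n}" "b \<in> {1..n}" "k \<in> {1..n}"
  shows "cyc_le n b k a"
proof (rule ccontr)
  assume "\<not> cyc_le n b k a"
  then have "cyc_less n b a k"
    by (simp add: cyc_le_def cyc_less_def)
  then show False
    using cyc_less_rotate[OF assms(4,6,3,5)] assms(1,2) by blast
qed

lemma cyc_max_eqI:
  assumes "S \<subseteq> {1..n}" "j \<in> S" "\<And>k. k \<in> S \<Longrightarrow> cyc_le n i k j"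
  shows "cyc_max n i S = j"
  unfolding cyc_max_def
proof (rule the_equality)
  fix j' assume "j' \<in> S \<and> (\<forall>k\<in>S. cyc_le n i k j')"
  then have "cyc_pos n i j' = cyc_pos n i j" "j' \<in> {1..n}" "j \<in> {1..n}"
    using assms by (auto simp: cyc_le_def intro: order_antisym)
  then show "j' = j"
    by (rule inj_onD[OF inj_on_cyc_pos])
qed (use assms in auto)

lemma cyc_max_exists:
  assumes "S \<subseteq> {1..n}" "S \<noteq> {}"
  obtains j where "j \<in> S" "\<And>k. k \<in> S \<Longrightarrow> cyc_le n i k j"
proof -
  have fin: "finite S"
    using assms finite_subset by blast
  have "Max (cyc_pos n i ` S) \<in> cyc_pos n i ` S"
    using fin assms by (intro Max_in) auto
  then obtain j where "j \<in> S" "cyc_pos n i j = Max (cyc_pos n i ` S)"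
    by auto
  then show ?thesis
    using fin that[of j] by (auto simp: cyc_le_def)
qed

section \<open>Gale order and the rank of a positroid\<close>

text \<open>The locale \<open>folding_insort_key\<close> asks for a key injective on an ambient set
  \<open>S\<close>; for \<open>cyc_pos\<close> this will be \<open>{1..n}\<close>.\<close>

lemma (in linorder) sorted_key_list_of_set_facts:
  assumes "inj_on f S" "A \<subseteq> S" "finite A"
  shows "set (sorted_key_list_of_set f A) = A"
    and "length (sorted_key_list_of_set f A) = card A"
    and "sorted (map f (sorted_key_list_of_set f A))"
    and "distinct (sorted_key_list_of_set f A)"
proof -
  interpret folding_insort_key "(\<le>)" "(<)" S f
    by unfold_locales (rule assms(1))
  show "set (sorted_key_list_of_set f A) = A"
    and "length (sorted_key_list_of_set f A) = card A"
    and "sorted (map f (sorted_key_list_of_set f A))"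
    and "distinct (sorted_key_list_of_set f A)"
    using assms(2,3) distinct_sorted_key_list_of_set[OF assms(2)]
    by (simp_all add: distinct_map)
qed

text \<open>If entry \<open>t\<close> of \<open>A\<close> came after entry \<open>t\<close> of
  \<open>B\<close>, the threshold at the latter would catch at least \<open>t + 1\<close> elements
  of \<open>B\<close> but at most \<open>t\<close> of \<open>A\<close>.\<close>

lemma gale_leI:
  assumes A: "A \<subseteq> {1..n}" and B: "B \<subseteq> {1..n}" and card: "card A = card B"
    and count: "\<And>k. card {x \<in> B. cyc_pos n i x \<le> k} \<le> card {x \<in> A. cyc_pos n i x \<le> k}"
  shows "gale_le n i A B"
  unfolding gale_le_def
proof (intro conjI allI impI)
  let ?f = "cyc_pos n i"
  define xs where "xs = sorted_key_list_of_set ?f A"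
  define ys where "ys = sorted_key_list_of_set ?f B"
  have fin: "finite A" "finite B"
    using A B finite_subset by blast+
  have xs: "set xs = A" "length xs = card A" "sorted (map ?f xs)"
    unfolding xs_def by (rule sorted_key_list_of_set_facts[OF inj_on_cyc_pos A fin(1)])+
  have ys: "set ys = B" "length ys = card B" "sorted (map ?f ys)" "distinct ys"
    unfolding ys_def by (rule sorted_key_list_of_set_facts[OF inj_on_cyc_pos B fin(2)])+
  fix t assume t: "t < card A"
  show "cyc_le n i (xs ! t) (ys ! t)"
  proof (rule ccontr)
    assume "\<not> cyc_le n i (xs ! t) (ys ! t)"
    then have lt: "?f (ys ! t) < ?f (xs ! t)"
      by (simp add: cyc_le_def)
    let ?k = "?f (ys ! t)"
    have "set (take (Suc t) ys) \<subseteq> {x \<in> B. ?f x \<le> ?k}"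
    proof
      fix x assume "x \<in> set (take (Suc t) ys)"
      then obtain s where "s \<le> t" "x = ys ! s"
        by (auto simp: in_set_conv_nth less_Suc_eq_le)
      then show "x \<in> {x \<in> B. ?f x \<le> ?k}"
        using sorted_nth_mono[OF ys(3), of s t] t ys(1,2) card by (auto simp: nth_mem)
    qed
    then have "card (set (take (Suc t) ys)) \<le> card {x \<in> B. ?f x \<le> ?k}"
      using fin by (intro card_mono) auto
    moreover have "card (set (take (Suc t) ys)) = Suc t"
      using ys t card by (simp add: distinct_card)
    moreover have "{x \<in> A. ?f x \<le> ?k} \<subseteq> set (take t xs)"
    proof
      fix x assume x: "x \<in> {x \<in> A. ?f x \<le> ?k}"
      then obtain s where s: "s < card A" "x = xs ! s"
        using xs by (auto simp: set_conv_nth)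
      have "s < t"
      proof (rule ccontr)
        assume "\<not> s < t"
        then have "?f (xs ! t) \<le> ?f (xs ! s)"
          using sorted_nth_mono[OF xs(3), of t s] s xs(2) by simp
        then show False
          using x s lt by simp
      qed
      then show "x \<in> set (take t xs)"
        using s xs by (auto simp: in_set_conv_nth)
    qed
    then have "card {x \<in> A. ?f x \<le> ?k} \<le> t"
      by (rule order_trans[OF card_mono[OF finite_set] order_trans[OF card_length]]) simp
    ultimately show False
      using count[of ?k] by simp
  qed
qed (rule card)

section \<open>Decorated permutations and the exchange between necklace entries\<close>

lemma decorated_permD:
  assumes "decorated_perm n p"
  shows "fst p permutes {1..n}"
    and "x \<in> {1..n} \<Longrightarrow> snd p x \<in> {0, 1, -1}"
    and "x \<notin> {1..n} \<Longrightarrow> snd p x = undefined"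
    and "x \<in> {1..n} \<Longrightarrow> snd p x = 0 \<longleftrightarrow> fst p x \<noteq> x"
proof -
  show "fst p permutes {1..n}"
    and "x \<in> {1..n} \<Longrightarrow> snd p x = 0 \<longleftrightarrow> fst p x \<noteq> x"
    using assms unfolding decorated_perm_def by simp_all
  have col: "snd p \<in> {1..n} \<rightarrow>\<^sub>E {0, 1, -1}"
    using assms unfolding decorated_perm_def by simp
  show "x \<in> {1..n} \<Longrightarrow> snd p x \<in> {0, 1, -1}"
    using PiE_mem[OF col] .
  show "x \<notin> {1..n} \<Longrightarrow> snd p x = undefined"
    using PiE_arb[OF col] .
qed

lemma decorated_perm_inv:
  assumes "decorated_perm n p" "x \<in> {1..n}"
  shows "inv (fst p) x \<in> {1..n}" and "fst p (inv (fst p) x) = x"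
    and "fst p y = x \<longleftrightarrow> y = inv (fst p) x"
proof -
  note perm = decorated_permD(1)[OF assms(1)]
  show "inv (fst p) x \<in> {1..n}"
    using permutes_in_image[OF permutes_inv[OF perm]] assms(2) by blast
  show "fst p (inv (fst p) x) = x"
    by (rule permutes_inverses(1)[OF perm])
  show "fst p y = x \<longleftrightarrow> y = inv (fst p) x"
    using permutes_inv_eq[OF perm, of x y] by auto
qed

lemma necklace_subset: "necklace n p i \<subseteq> {1..n}"
  by (auto simp: necklace_def)

lemma finite_necklace: "finite (necklace n p i)"
  by (rule finite_subset[OF necklace_subset]) simp

text \<open>
  Passing from \<open>I\<^sub>i\<close> to \<open>I\<^sub>a\<close> trades the values leaving the initial segment \<open>L = [i, a)\<close> of \<open><\<^sub>i\<close> for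
  the equally many values entering it.
\<close>

lemma necklace_exchange:
  assumes p: "decorated_perm n p" and i: "i \<in> {1..n}" and a: "a \<in> {1..n}"
  obtains L G H where "L = {x \<in> {1..n}. cyc_less n i x a}" "G \<subseteq> L" "H \<inter> L = {}"
    "G \<subseteq> necklace n p i" "finite H" "card G = card H"
    "necklace n p i \<inter> H = {}" "necklace n p a = (necklace n p i - G) \<union> H"
proof -
  let ?f = "fst p"
  define L where "L = {x \<in> {1..n}. cyc_less n i x a}"
  define G where "G = L - ?f ` L"
  define H where "H = ?f ` L - L"
  have fin: "finite L"
    by (simp add: L_def)
  have perm: "?f permutes {1..n}"
    using decorated_permD(1)[OF p] .
  \<comment> \<open>Injectivity gives \<open>L\<close> and its image the same size, hence also their
    two set differences.\<close>
  have "card (?f ` L) = card L"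
    using perm by (intro card_image) (metis inj_on_subset permutes_inj subset_UNIV)
  then have card: "card G = card H"
    using fin by (simp add: G_def H_def card_Diff_subset_Int Int_commute)
  have img: "x \<in> ?f ` L \<longleftrightarrow> inv ?f x \<in> L" if "x \<in> {1..n}" for x
    using decorated_perm_inv[OF p that] by (metis imageE imageI)
  have L: "L \<subseteq> {1..n}" "?f ` L \<subseteq> {1..n}"
    using permutes_in_image[OF perm] by (auto simp: L_def simp del: atLeastAtMost_iff)
  \<comment> \<open>Coloops are fixed points, so they occur neither in \<open>G\<close> nor in
    \<open>H\<close>.\<close>
  have fix_col: "inv ?f x = x" if "x \<in> {1..n}" "snd p x = -1" for x
    using decorated_perm_inv[OF p that(1)] decorated_permD(4)[OF p that(1)] that(2) by fastforce
  have G_mem: "x \<in> G \<longleftrightarrow> x \<in> L \<and> inv ?f x \<notin> L" if "x \<in> {1..n}" for x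
    using img[OF that] by (auto simp: G_def)
  have H_mem: "x \<in> H \<longleftrightarrow> x \<notin> L \<and> inv ?f x \<in> L" if "x \<in> {1..n}" for x
    using img[OF that] by (auto simp: H_def)
  have sub: "G \<subseteq> {1..n}" "H \<subseteq> {1..n}"
    using L by (auto simp: G_def H_def)
  have in_i: "x \<in> necklace n p i" if "x \<in> G" for x
  proof -
    have "x \<in> {1..n}" using that sub by auto
    then show ?thesis
      using that G_mem decorated_perm_inv(1)[OF p, of x]
      by (auto simp: necklace_def L_def cyc_less_def)
  qed
  have notin_i: "x \<notin> necklace n p i" if "x \<in> H" for x
  proof -
    have x: "x \<in> {1..n}" using that sub by auto
    then show ?thesis
      using that H_mem decorated_perm_inv(1)[OF p, of x] fix_col[OF x]
      by (auto simp: necklace_def L_def cyc_less_def)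
  qed
  have mem: "x \<in> necklace n p a \<longleftrightarrow> x \<in> (necklace n p i - G) \<union> H" if x: "x \<in> {1..n}" for x
  proof -
    have y: "inv ?f x \<in> {1..n}" using decorated_perm_inv(1)[OF p x] .
    have fc: "inv ?f x = x" if "snd p x = -1" using fix_col[OF x that] .
    show ?thesis
      using x y fc unfolding Un_iff Diff_iff G_mem[OF x] H_mem[OF x]
      by (auto simp: necklace_def L_def cyc_less_rotate[OF x y i a])
  qed
  have "necklace n p a = (necklace n p i - G) \<union> H"
    using mem necklace_subset[of n p] sub by blast
  then show ?thesis
    using that[of L G H] card in_i notin_i fin by (auto simp: L_def G_def H_def)
qed

text \<open>The exchange removes and adds equally many values. This carries the rank, read off at
  index \<open>1\<close>, to every index.\<close>

lemma card_necklace_eq: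
  assumes "decorated_perm n p" "i \<in> {1..n}" "a \<in> {1..n}"
  shows "card (necklace n p i) = card (necklace n p a)"
proof -
  obtain L :: "nat set" and G H where *: "G \<subseteq> necklace n p i" "finite H" "card G = card H"
    "necklace n p i \<inter> H = {}" "necklace n p a = (necklace n p i - G) \<union> H"
    using necklace_exchange[OF assms] by metis
  have "finite (necklace n p i)" by (rule finite_necklace)
  then have "card (necklace n p a) = card (necklace n p i) - card G + card H"
    using * by (subst *(5), subst card_Un_disjoint)
      (auto simp: card_Diff_subset finite_subset)
  moreover have "card G \<le> card (necklace n p i)"
    using * finite_necklace card_mono by blast
  ultimately show ?thesis using * by simp
qed

text \<open>A threshold reaching \<open>a\<close> counts all of \<open>G\<close>, which outweighs
  any gain from \<open>H\<close>; a threshold before \<open>a\<close> counts only elements of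
  \<open>L\<close>, and \<open>H\<close> avoids \<open>L\<close>.\<close>

lemma gale_le_necklace:
  assumes p: "decorated_perm n p" and i: "i \<in> {1..n}" and a: "a \<in> {1..n}"
  shows "gale_le n i (necklace n p i) (necklace n p a)"
proof (rule gale_leI)
  fix k
  obtain L G H where *: "L = {x \<in> {1..n}. cyc_less n i x a}" "G \<subseteq> L" "H \<inter> L = {}"
    "G \<subseteq> necklace n p i" "finite H" "card G = card H"
    "necklace n p i \<inter> H = {}" "necklace n p a = (necklace n p i - G) \<union> H"
    by (rule necklace_exchange[OF assms]) (rule that)
  let ?X = "{x. cyc_pos n i x \<le> k}"
  have fin: "finite (necklace n p i)" by (rule finite_necklace)
  have "card (necklace n p a \<inter> ?X) \<le> card (necklace n p i \<inter> ?X)"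
  proof (cases "cyc_pos n i a \<le> k")
    case True
    then have GX: "G \<subseteq> necklace n p i \<inter> ?X"
      using * by (auto simp: cyc_less_def)
    have "card (necklace n p a \<inter> ?X) \<le> card ((necklace n p i \<inter> ?X - G) \<union> H)"
      using * fin by (intro card_mono) auto
    also have "\<dots> \<le> card (necklace n p i \<inter> ?X - G) + card H"
      by (rule card_Un_le)
    also have "card (necklace n p i \<inter> ?X - G) = card (necklace n p i \<inter> ?X) - card G"
      using GX fin by (intro card_Diff_subset) (auto intro: finite_subset)
    also have "\<dots> + card H = card (necklace n p i \<inter> ?X)"
      using card_mono[OF _ GX] fin *(6) by simp
    finally show ?thesis .
  next
    case False
    have "x \<in> L" if "x \<in> H" "x \<in> ?X" for x
    proof -
      have "x \<in> {1..n}" using that * necklace_subset by blast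
      then show ?thesis using that False *(1) by (auto simp: cyc_less_def)
    qed
    then show ?thesis
      using * fin by (intro card_mono) auto
  qed
  moreover have "{x \<in> S. cyc_pos n i x \<le> k} = S \<inter> ?X" for S
    by auto
  ultimately show "card {x \<in> necklace n p a. cyc_pos n i x \<le> k}
      \<le> card {x \<in> necklace n p i. cyc_pos n i x \<le> k}"
    by simp
qed (use card_necklace_eq[OF assms] necklace_subset in auto)

text \<open>All bases have this size by definition; the necklace entry at \<open>1\<close> is itself
  a basis, so the set of sizes is a singleton rather than empty.\<close>

lemma rk_positroid_of:
  assumes "decorated_perm n p"
  shows "rk (positroid_of n p) = card (necklace n p 1)"
proof -
  have "necklace n p 1 \<in> positroid_of n p"
    using gale_le_necklace[OF assms] necklace_subset by (auto simp: positroid_of_def)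
  then have "card ` positroid_of n p = {card (necklace n p 1)}"
    by (auto simp: positroid_of_def)
  then show ?thesis
    by (auto simp: rk_def)
qed

section \<open>Necklaces of cyclic shifts\<close>

text \<open>A shift moves each value placed in \<open>C\<close>, the complement of \<open>A\<close>,
  to the next position of \<open>C\<close>. Seen from \<open>i\<close>, this position is later
  unless the move wraps around, which happens only at the maximum \<open>c\<close>; so only
  \<open>fst p c\<close> can be lost.\<close>

lemma necklace_shift_subset:
  assumes p: "decorated_perm n p" and q: "decorated_perm n q" and i: "i \<in> {1..n}"
    and card: "card (necklace n p i) = Suc (card (necklace n q i))"
    and shift: "q = cyclic_shift n A p"
  shows "necklace n q i \<subseteq> necklace n p i"
proof (cases "{1..n} - A = {}")
  case True
  then have "q = p"
    unfolding shift cyclic_shift_def shift_perm_def True by (simp add: prod_eq_iff)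
  then show ?thesis by simp
next
  case False
  define C where "C = {1..n} - A"
  have C: "C \<subseteq> {1..n}" "C \<noteq> {}"
    using False by (auto simp: C_def)
  obtain c where c: "c \<in> C" "\<And>k. k \<in> C \<Longrightarrow> cyc_le n i k c"
    using cyc_max_exists[OF C] by metis
  let ?f = "fst p" and ?g = "fst q"
  have g_C: "?g b = ?f (cyc_max n b C)" if "b \<in> C" for b
    using that by (simp add: shift cyclic_shift_def shift_perm_def C_def)
  have nC: "?g b = ?f b" "snd q b = snd p b" if "b \<notin> C" for b
    using that by (auto simp: shift cyclic_shift_def shift_perm_def C_def)
  have "necklace n p i - {?f c} \<subseteq> necklace n q i"
  proof
    fix v assume v: "v \<in> necklace n p i - {?f c}"
    then have vn: "v \<in> {1..n}" by (auto simp: necklace_def)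
    define a where "a = inv ?f v"
    have a: "a \<in> {1..n}" "?f a = v"
      using decorated_perm_inv[OF p vn] by (auto simp: a_def)
    have va: "cyc_less n i v a \<or> snd p v = -1 \<and> v = a"
      using v decorated_permD(4)[OF p vn] decorated_perm_inv(3)[OF p vn, of v]
      by (auto simp: necklace_def a_def)
    show "v \<in> necklace n q i"
    proof (cases "a \<in> C")
      case False
      then have "inv ?g v = a"
        using a decorated_perm_inv(3)[OF q vn] nC(1) by metis
      then show ?thesis
        using va vn nC(2)[OF False] by (auto simp: necklace_def)
    next
      case True
      have "a \<noteq> c" using v a by auto
      then have ac: "cyc_less n i a c"
        using c(2)[OF True] True c(1) C by (intro cyc_less_if_le) auto
      \<comment> \<open>The next element of \<open>C\<close> after \<open>a\<close>;
        \<open>c\<close> shows that there is one before wrapping around.\<close>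
      obtain b where b: "b \<in> C" "cyc_less n i a b"
        and least: "\<And>k. k \<in> C \<Longrightarrow> cyc_less n i a k \<Longrightarrow> cyc_le n i b k"
        using ex_has_least_nat[of "\<lambda>b. b \<in> C \<and> cyc_less n i a b" c "cyc_pos n i"] ac c(1)
        by (auto simp: cyc_le_def)
      have "cyc_max n b C = a"
      proof (rule cyc_max_eqI[OF C(1) True])
        fix k assume k: "k \<in> C"
        then have "k \<in> {1..n}" "b \<in> {1..n}" using b C by auto
        then show "cyc_le n b k a"
          using least[OF k] b(2) a(1) i
          by (intro cyc_le_of_successor[of n i]) (auto simp: cyc_le_def cyc_less_def)
      qed
      then have "inv ?g v = b"
        using g_C[OF b(1)] a decorated_perm_inv(3)[OF q vn] by metis
      then show ?thesis
        using va vn b(2) by (auto simp: necklace_def cyc_less_def)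
    qed
  qed
  \<comment> \<open>The inclusion just shown goes into a set that is no larger, so it is an
    equality.\<close>
  moreover have "card (necklace n q i) \<le> card (necklace n p i - {?f c})"
    using card finite_necklace[of n p i] by (simp add: card_Diff_singleton_if)
  ultimately show ?thesis
    using card_seteq[OF finite_necklace] by blast
qed

section \<open>From containment of necklaces to a cyclic shift\<close>

text \<open>For \<open>a = p\<^sup>-\<^sup>1 v\<close> and \<open>b = q\<^sup>-\<^sup>1 v\<close>, the hypothesis \<open>b \<le>\<^sub>m a\<close> says that \<open>m\<close> lies in \<open>(a, b]\<close>.\<close>

lemma necklace_lost:
  assumes p: "decorated_perm n p" and q: "decorated_perm n q"
    and sub: "\<And>i. i \<in> {1..n} \<Longrightarrow> necklace n q i \<subseteq> necklace n p i"
    and ab: "a \<in> {1..n}" "b \<in> {1..n}" and v: "fst p a = v" "fst q b = v"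
    and ne: "a = b \<Longrightarrow> snd p a \<noteq> snd q a"
    and m: "m \<in> {1..n}" "cyc_le n m b a"
  shows "v \<in> necklace n p m - necklace n q m" and "b = v \<Longrightarrow> snd q v = 1"
proof -
  have vn: "v \<in> {1..n}"
    using ab v decorated_permD(1)[OF p] permutes_in_image by fastforce
  have inv: "inv (fst p) v = a" "inv (fst q) v = b"
    using decorated_perm_inv(3)[OF p vn] decorated_perm_inv(3)[OF q vn] v by metis+
  have memp: "v \<in> necklace n p i \<longleftrightarrow> cyc_less n i v a \<or> snd p v = -1" for i
    using vn inv by (simp add: necklace_def)
  have memq: "v \<in> necklace n q i \<longleftrightarrow> cyc_less n i v b \<or> snd q v = -1" for i
    using vn inv by (simp add: necklace_def)
  have colp: "snd p v \<in> {0, 1, -1}" "snd p v = 0 \<longleftrightarrow> a \<noteq> v"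
    using decorated_permD(2,4)[OF p vn] decorated_perm_inv(3)[OF p vn, of v] inv by auto
  have colq: "snd q v \<in> {0, 1, -1}" "snd q v = 0 \<longleftrightarrow> b \<noteq> v"
    using decorated_permD(2,4)[OF q vn] decorated_perm_inv(3)[OF q vn, of v] inv by auto
  \<comment> \<open>A coloop of \<open>q\<close> lies in every entry of its necklace, hence in
    \<open>necklace n p a\<close>. As \<open>a\<close> is first under \<open><\<^sub>a\<close>, it
    must be a coloop of \<open>p\<close> too, against \<open>ne\<close>.\<close>
  show loop: "snd q v = 1" if "b = v"
  proof (rule ccontr)
    assume "snd q v \<noteq> 1"
    then have "snd q v = -1" using colq that by auto
    then have "v \<in> necklace n p a"
      using memq sub[OF ab(1)] by blast
    then have "snd p v = -1"
      using memp ab vn by (auto simp: cyc_less_def cyc_pos_def split: if_splits)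
    then show False
      using \<open>snd q v = -1\<close> colp ne that by auto
  qed
  show "v \<in> necklace n p m - necklace n q m"
  proof (cases "b = v")
    case True
    then have "v \<notin> necklace n q m"
      using memq loop by (simp add: cyc_less_def)
    moreover have "v \<in> necklace n p m"
    proof (cases "a = v")
      case True
      then have "snd p v = -1"
        using colp ne loop \<open>b = v\<close> by auto
      then show ?thesis using memp by simp
    next
      case False
      then show ?thesis
        using memp m \<open>b = v\<close> ab by (auto simp: cyc_less_def cyc_le_def cyc_pos_def split: if_splits)
    qed
    ultimately show ?thesis by simp
  next
    case False
    \<comment> \<open>The cyclic successor of \<open>b\<close>: under \<open><\<^sub>s\<close> the
      position \<open>b\<close> is last, so \<open>v\<close> is in \<open>necklace n q s\<close> and
      containment applies there.\<close>
    define s where "s = (if b = n then 1 else Suc b)"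
    have s: "s \<in> {1..n}" using ab by (auto simp: s_def)
    have "v \<in> necklace n q s"
      using memq False vn ab by (auto simp: s_def cyc_less_def cyc_pos_def)
    then have vs: "cyc_less n s v a \<or> snd p v = -1"
      using sub[OF s] memp by auto
    \<comment> \<open>A common position different from \<open>v\<close> would have colour
      \<open>0\<close> in both.\<close>
    have "a \<noteq> b"
      using ne ab v False decorated_permD(4)[OF p] decorated_permD(4)[OF q] by metis
    then have mb: "cyc_less n m b a"
      using m ab by (intro cyc_less_if_le) auto
    show ?thesis
    proof (cases "a = v")
      case True
      then show ?thesis
        using vs mb memp memq False colq by (auto simp: cyc_less_def)
    next
      case neq: False
      then have "cyc_less n s v a" using vs colp by auto
      \<comment> \<open>Going round from just after \<open>b\<close> one meets \<open>v\<close>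
        before \<open>a\<close>; since \<open>m\<close> is in \<open>(a, b]\<close>, the order from
        \<open>m\<close> is \<open>b, v, a\<close>.\<close>
      then have "cyc_less n m v a \<and> \<not> cyc_less n m v b"
        using mb m(1) ab vn False neq \<open>a \<noteq> b\<close>
        by (auto simp: s_def cyc_less_def cyc_pos_def split: if_splits)
      then show ?thesis
        using memp memq False colq by auto
    qed
  qed
qed

text \<open>Let \<open>C\<close> be the set of disagreement and let a value move from
  \<open>j\<close> to \<open>i\<close>. Another \<open>k\<close> in \<open>C\<close> strictly
  between them would make both \<open>fst p j\<close> and \<open>fst p k\<close> disappear at the
  index after \<open>k\<close>, but only one value is lost at each index.\<close>

lemma necklace_subset_imp_shift:
  assumes p: "decorated_perm n p" and q: "decorated_perm n q"
    and sub: "\<And>i. i \<in> {1..n} \<Longrightarrow> necklace n q i \<subseteq> necklace n p i"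
    and card: "\<And>i. i \<in> {1..n} \<Longrightarrow> card (necklace n p i) = Suc (card (necklace n q i))"
  shows "q = cyclic_shift n {i \<in> {1..n}. fst q i = fst p i \<and> snd q i = snd p i} p"
proof -
  define C where "C = {i \<in> {1..n}. \<not> (fst q i = fst p i \<and> snd q i = snd p i)}"
  let ?A = "{i \<in> {1..n}. fst q i = fst p i \<and> snd q i = snd p i}"
  have C: "C \<subseteq> {1..n}" "{1..n} - ?A = C"
    by (auto simp: C_def)
  have pn: "fst p x \<in> {1..n} \<longleftrightarrow> x \<in> {1..n}" and qn: "fst q x \<in> {1..n} \<longleftrightarrow> x \<in> {1..n}" for x
    using decorated_permD(1)[OF p] decorated_permD(1)[OF q] by (simp_all only: permutes_in_image)
  have unique: "v = w"
    if "m \<in> {1..n}" "v \<in> necklace n p m - necklace n q m" "w \<in> necklace n p m - necklace n q m" for m v w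
  proof -
    have "card (necklace n p m - necklace n q m) = 1"
      using card sub that(1) finite_necklace by (simp add: card_Diff_subset)
    then show ?thesis
      using that by (metis card_1_singletonE singletonD)
  qed
  have C_step: "fst q i = fst p (cyc_max n i C)" "fst q i = i \<Longrightarrow> snd q i = 1" if i: "i \<in> C" for i
  proof -
    define v where "v = fst q i"
    have i_n: "i \<in> {1..n}" using i C by auto
    then have vn: "v \<in> {1..n}" using qn by (simp only: v_def)
    define j where "j = inv (fst p) v"
    have j: "j \<in> {1..n}" "fst p j = v"
      using decorated_perm_inv[OF p vn] by (auto simp: j_def)
    have qi: "fst q x = v \<longleftrightarrow> x = i" for x
      using decorated_perm_inv(3)[OF q vn] v_def by metis
    \<comment> \<open>Agreement at \<open>j\<close> would give \<open>fst q j = v\<close>, hence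
      \<open>j = i\<close>, which is in \<open>C\<close>.\<close>
    have jC: "j \<in> C"
      using j qi[of j] i by (auto simp: C_def v_def)
    have ne: "snd p j \<noteq> snd q j" if "j = i"
      using i that j by (auto simp: C_def v_def)
    have lost: "v \<in> necklace n p m - necklace n q m" "i = v \<Longrightarrow> snd q v = 1"
      if "m \<in> {1..n}" "cyc_le n m i j" for m
      using necklace_lost[OF p q _ j(1) i_n j(2) v_def[symmetric] _ that] sub ne by blast+
    have "cyc_le n i i j"
      using j(1) i_n by (auto simp: cyc_le_def cyc_pos_def)
    from lost(2)[OF i_n this] show "snd q i = 1" if "fst q i = i"
      using that by (simp add: v_def)
    have "cyc_le n i k j" if k: "k \<in> C" for k
    proof (rule ccontr)
      assume "\<not> cyc_le n i k j"
      then have jk: "cyc_less n i j k"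
        by (simp add: cyc_le_def cyc_less_def)
      define w where "w = fst p k"
      define b where "b = inv (fst q) w"
      \<comment> \<open>The index just after \<open>k\<close>, wrapping at \<open>n\<close>:
        \<open>k\<close> is last under \<open><\<^sub>m\<close>, so \<open>w\<close> is lost at
        \<open>m\<close> wherever \<open>b\<close> lies.\<close>
      define m where "m = (if k = n then 1 else Suc k)"
      have k_n: "k \<in> {1..n}" using k C by auto
      then have wn: "w \<in> {1..n}" using pn by (simp only: w_def)
      have m: "m \<in> {1..n}" using k_n by (auto simp: m_def)
      have b: "b \<in> {1..n}" "fst q b = w"
        using decorated_perm_inv(1,2)[OF q wn] by (auto simp: b_def)
      have ne': "snd p k \<noteq> snd q k" if "k = b"
        using k that b by (auto simp: C_def w_def)
      have "cyc_le n m b k"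
        using b(1) k_n by (auto simp: m_def cyc_le_def cyc_pos_def)
      then have lost_w: "w \<in> necklace n p m - necklace n q m"
        using necklace_lost(1)[OF p q _ k_n b(1) w_def[symmetric] b(2) _ m] sub ne' by blast
      \<comment> \<open>As \<open>k\<close> lies after \<open>j\<close> and before the return to
        \<open>i\<close>, the index \<open>m\<close> is in \<open>(j, i]\<close>, so
        \<open>v\<close> is lost there as well.\<close>
      have "cyc_le n m i j"
        using jk j(1) k_n i_n
        by (auto simp: m_def cyc_le_def cyc_less_def cyc_pos_def split: if_splits)
      then have "w = v"
        using unique[OF m lost_w] lost(1)[OF m] by blast
      then have "k = j"
        using decorated_perm_inv(3)[OF p vn] j(2) w_def by metis
      then show False using jk by (simp add: cyc_less_def)
    qed
    then have "cyc_max n i C = j"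
      by (rule cyc_max_eqI[OF C(1) jC])
    then show "fst q i = fst p (cyc_max n i C)"
      using j v_def by simp
  qed
  \<comment> \<open>Outside \<open>{1..n}\<close> both permutations are the identity and both
    colourings are \<open>undefined\<close>.\<close>
  have off_C: "fst q x = fst p x" "snd q x = snd p x" if "x \<notin> C" for x
    using that permutes_not_in[OF decorated_permD(1)[OF p], of x]
      permutes_not_in[OF decorated_permD(1)[OF q], of x]
      decorated_permD(3)[OF p, of x] decorated_permD(3)[OF q, of x]
    by (cases "x \<in> {1..n}"; simp add: C_def)+
  have fst_eq: "fst q x = shift_perm n ?A (fst p) x" for x
    using C_step(1)[of x] off_C(1)[of x] unfolding shift_perm_def C(2) by presburger
  have snd_eq: "snd q x = (if x \<in> {1..n} - ?A
      then (if shift_perm n ?A (fst p) x = x then 1 else 0) else snd p x)" for x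
  proof (cases "x \<in> C")
    case True
    then have "x \<in> {1..n}" using C by blast
    from decorated_permD(4)[OF q this] C_step(2)[OF True] True show ?thesis
      unfolding C(2) fst_eq[symmetric] by presburger
  next
    case False
    then show ?thesis
      unfolding C(2) using off_C(2) by presburger
  qed
  show ?thesis
    unfolding cyclic_shift_def
    by (rule prod_eqI; rule ext; simp only: fst_conv snd_conv; rule fst_eq snd_eq)
qed

theorem theorem3p15:
  fixes n :: nat and M N :: "nat set set" and \<sigma> \<pi> :: dperm
  assumes "positroid n M" and "positroid n N"
    and "int (rk M) = int (rk N) - 1"
    and "is_dperm_of n \<sigma> M" and "is_dperm_of n \<pi> N"
  shows "(\<forall>i\<in>{1..n}. necklace n \<sigma> i \<subseteq> necklace n \<pi> i) \<longleftrightarrow>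
         (\<exists>A. A \<subseteq> {1..n} \<and> \<sigma> = cyclic_shift n A \<pi>)"
proof -
  have s: "decorated_perm n \<sigma>" and p: "decorated_perm n \<pi>"
    and "M = positroid_of n \<sigma>" "N = positroid_of n \<pi>"
    using assms(4,5) by (auto simp: is_dperm_of_def)
  then have "card (necklace n \<pi> 1) = Suc (card (necklace n \<sigma> 1))"
    using assms(3) rk_positroid_of by simp
  then have card: "card (necklace n \<pi> i) = Suc (card (necklace n \<sigma> i))" if "i \<in> {1..n}" for i
    using that card_necklace_eq[OF s that, of 1] card_necklace_eq[OF p that, of 1] by auto
  show ?thesis
  proof
    assume "\<forall>i\<in>{1..n}. necklace n \<sigma> i \<subseteq> necklace n \<pi> i"
    then have "\<sigma> = cyclic_shift n {i \<in> {1..n}. fst \<sigma> i = fst \<pi> i \<and> snd \<sigma> i = snd \<pi> i} \<pi>"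
      using necklace_subset_imp_shift[OF p s] card by blast
    then show "\<exists>A. A \<subseteq> {1..n} \<and> \<sigma> = cyclic_shift n A \<pi>"
      by (intro exI[of _ "{i \<in> {1..n}. fst \<sigma> i = fst \<pi> i \<and> snd \<sigma> i = snd \<pi> i}"]) blast
  next
    assume "\<exists>A. A \<subseteq> {1..n} \<and> \<sigma> = cyclic_shift n A \<pi>"
    then show "\<forall>i\<in>{1..n}. necklace n \<sigma> i \<subseteq> necklace n \<pi> i"
      using necklace_shift_subset[OF p s _ card] by blast
  qed
qed

end
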